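(* Let $L$ be a $BL$-algebra, let $\alpha,\beta\in(0,1]$ with $\alpha<\beta$, and let $F:L\to[0,1]$ be a fuzzy set. Then $F$ is a fuzzy filter with thresholds $(\alpha,\beta]$ of $L$ if and only if for every $t$ with $\alpha<t\le\beta$ for which $U(F;t)=\{x\in L\mid F(x)\ge t\}$ is non-empty, $U(F;t)$ is a filter of $L$.
   Context: A $BL$-algebra is an algebra $(L,\le,\wedge,\vee,\odot,\rightarrow,0,1)$ that is a bounded lattice (least element $0$, greatest element $1$) such that $(L,\odot,1)$ is a commutative monoid, $z\le x\rightarrow y$ iff $x\odot z\le y$, $x\wedge y=x\odot(x\rightarrow y)$, and $(x\rightarrow y)\vee(y\rightarrow x)=1$, for all $x,y,z\in L$. A filter of $L$ is a non-empty subset $A\subseteq L$ with $1\in A$ such that $x\in A$ and $x\rightarrow y\in A$ imply $y\in A$. A fuzzy set $F$ is a fuzzy filter with thresholds $(\alpha,\beta]$ of $L$ if for all $x,y\in L$: $\max\{F(x\odot y),\alpha\}\ge\min\{F(x),F(y),\beta\}$, and, whenever $x\le y$, $\max\{F(y),\alpha\}\ge\min\{F(x),\beta\}$. *)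

theory Defs
  imports Complex_Main
begin

text \<open>
  The carrier $L$ is the type itself.  The product and its unit are \<open>(*)\<close> and \<open>1\<close>, the lattice
  operations are \<^const>\<open>inf\<close> and \<^const>\<open>sup\<close>, and the least element is \<^const>\<open>bot\<close>.  The greatest
  element \<^const>\<open>top\<close> and the unit are distinct constants in the library classes, so their
  identification is an axiom.
\<close>

class bl_algebra = bounded_lattice + comm_monoid_mult +
  fixes residuum :: "'a \<Rightarrow> 'a \<Rightarrow> 'a"  (infixr "\<leadsto>" 60)
  assumes top_eq_one: "top = 1"
    and residuation: "z \<le> (x \<leadsto> y) \<longleftrightarrow> x * z \<le> y"
    and divisibility: "inf x y = x * (x \<leadsto> y)"
    and prelinearity: "sup (x \<leadsto> y) (y \<leadsto> x) = 1"

definition bl_filter :: "'a::bl_algebra set \<Rightarrow> bool" where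
  "bl_filter A \<longleftrightarrow> A \<noteq> {} \<and> 1 \<in> A \<and> (\<forall>x y. x \<in> A \<longrightarrow> (x \<leadsto> y) \<in> A \<longrightarrow> y \<in> A)"

definition fuzzy_set :: "('a \<Rightarrow> real) \<Rightarrow> bool" where
  "fuzzy_set F \<longleftrightarrow> (\<forall>x. 0 \<le> F x \<and> F x \<le> 1)"

definition level_set :: "('a \<Rightarrow> real) \<Rightarrow> real \<Rightarrow> 'a set" where
  "level_set F t = {x. F x \<ge> t}"

definition fuzzy_filter_thresholds :: "real \<Rightarrow> real \<Rightarrow> ('a::bl_algebra \<Rightarrow> real) \<Rightarrow> bool" where
  "fuzzy_filter_thresholds \<alpha> \<beta> F \<longleftrightarrow>
     fuzzy_set F \<and>
     (\<forall>x y. max (F (x * y)) \<alpha> \<ge> min (F x) (min (F y) \<beta>)) \<and>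
     (\<forall>x y. x \<le> y \<longrightarrow> max (F y) \<alpha> \<ge> min (F x) \<beta>)"

end

theory Submission
  imports Defs
begin

text \<open>
  Filters are exactly the non-empty up-sets closed under the product.  In this form both conditions
  on a fuzzy filter are level-wise: a violation of either one is a violation of the corresponding
  closure property by the level set whose level \<open>t\<close> is the violated minimum.
\<close>

lemma residuum_eq_one_iff:
  fixes x y :: "'a::bl_algebra"
  shows "(x \<leadsto> y) = 1 \<longleftrightarrow> x \<le> y"
proof -
  have "(x \<leadsto> y) = 1 \<longleftrightarrow> 1 \<le> (x \<leadsto> y)"
    by (metis top_eq_one top_unique)
  also have "\<dots> \<longleftrightarrow> x \<le> y"
    by (simp add: residuation)
  finally show ?thesis .
qed

text \<open>Modus ponens as an inequality: residuation applied to reflexivity of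
  \<open>\<le>\<close> at \<open>x \<leadsto> y\<close>.\<close>

lemma mult_residuum_le:
  fixes x y :: "'a::bl_algebra"
  shows "x * (x \<leadsto> y) \<le> y"
  by (simp add: residuation[symmetric])

text \<open>If \<open>x \<le> y\<close>, the residuum \<open>x \<leadsto> y\<close> is
  \<open>1\<close>, so detachment yields upward closure, and with it closure under products.
  Conversely, detachment follows because the product of \<open>x\<close> and
  \<open>x \<leadsto> y\<close> lies in \<open>A\<close> and below \<open>y\<close>.\<close>

lemma bl_filter_iff_upset_mult_closed:
  fixes A :: "'a::bl_algebra set"
  shows "bl_filter A \<longleftrightarrow>
    A \<noteq> {} \<and> (\<forall>x\<in>A. \<forall>y\<in>A. x * y \<in> A) \<and> (\<forall>x\<in>A. \<forall>y. x \<le> y \<longrightarrow> y \<in> A)"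
    (is "_ \<longleftrightarrow> ?R")
proof
  assume A: "bl_filter A"
  have up: "y \<in> A" if "x \<in> A" "x \<le> y" for x y
  proof -
    have "(x \<leadsto> y) \<in> A"
      using A that(2) by (simp add: bl_filter_def residuum_eq_one_iff[THEN iffD2])
    with A that(1) show ?thesis
      unfolding bl_filter_def by blast
  qed
  have "x * y \<in> A" if "x \<in> A" "y \<in> A" for x y
  proof -
    \<comment> \<open>This is \<open>y * x \<le> x * y\<close> read through residuation; detaching
      \<open>y\<close> then leaves the product.\<close>
    have "x \<le> (y \<leadsto> x * y)"
      by (simp add: residuation mult.commute)
    then have "(y \<leadsto> x * y) \<in> A"
      using up that(1) by blast
    then show ?thesis
      using A that(2) unfolding bl_filter_def by blast
  qed
  moreover have "A \<noteq> {}"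
    using A by (simp add: bl_filter_def)
  ultimately show ?R
    using up by blast
next
  assume R: ?R
  \<comment> \<open>As \<open>1\<close> is the top element, upward closure reaches it from any
    member of \<open>A\<close>.\<close>
  then have "1 \<in> A"
    by (metis ex_in_conv top_eq_one top_greatest)
  moreover have "y \<in> A" if "x \<in> A" "(x \<leadsto> y) \<in> A" for x y
    using R that mult_residuum_le[of x y] by blast
  ultimately show "bl_filter A"
    unfolding bl_filter_def by blast
qed

theorem theorem2p8:
  fixes F :: "'a::bl_algebra \<Rightarrow> real" and \<alpha> \<beta> :: real
  assumes "0 < \<alpha>" "\<alpha> \<le> 1" "0 < \<beta>" "\<beta> \<le> 1" "\<alpha> < \<beta>"
    and "fuzzy_set F"
  shows "fuzzy_filter_thresholds \<alpha> \<beta> F \<longleftrightarrow>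
    (\<forall>t. \<alpha> < t \<and> t \<le> \<beta> \<and> level_set F t \<noteq> {} \<longrightarrow> bl_filter (level_set F t))"
proof
  assume F: "fuzzy_filter_thresholds \<alpha> \<beta> F"
  have mult: "max (F (x * y)) \<alpha> \<ge> min (F x) (min (F y) \<beta>)" for x y
    using F by (simp add: fuzzy_filter_thresholds_def)
  have mono: "max (F y) \<alpha> \<ge> min (F x) \<beta>" if "x \<le> y" for x y
    using F that by (simp add: fuzzy_filter_thresholds_def)
  show "\<forall>t. \<alpha> < t \<and> t \<le> \<beta> \<and> level_set F t \<noteq> {} \<longrightarrow> bl_filter (level_set F t)"
  proof (intro allI impI)
    fix t
    assume t: "\<alpha> < t \<and> t \<le> \<beta> \<and> level_set F t \<noteq> {}"
    \<comment> \<open>Because \<open>t \<le> \<beta>\<close>, the minimum is at least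
      \<open>t\<close>; because \<open>\<alpha> < t\<close>, the maximum can reach \<open>t\<close>
      only through \<open>F (x * y)\<close>.\<close>
    have "t \<le> F (x * y)" if "t \<le> F x" "t \<le> F y" for x y
      using mult[of x y] t that by linarith
    moreover have "t \<le> F y" if "t \<le> F x" "x \<le> y" for x y
      using mono[of x y] t that by linarith
    ultimately show "bl_filter (level_set F t)"
      using t unfolding bl_filter_iff_upset_mult_closed by (auto simp: level_set_def)
  qed
next
  assume levels: "\<forall>t. \<alpha> < t \<and> t \<le> \<beta> \<and> level_set F t \<noteq> {} \<longrightarrow> bl_filter (level_set F t)"
  have level: "bl_filter (level_set F t)" if "\<alpha> < t" "t \<le> \<beta>" "t \<le> F x" for t x
    using levels that by (auto simp: level_set_def)
  have "max (F (x * y)) \<alpha> \<ge> min (F x) (min (F y) \<beta>)" (is "_ \<ge> ?t") for x y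
  \<comment> \<open>If \<open>?t \<le> \<alpha>\<close>, the \<open>\<alpha>\<close> inside the
    maximum settles the claim. Otherwise \<open>?t\<close> is an admissible level, since
    \<open>?t \<le> \<beta>\<close>, and its level set contains both \<open>x\<close> and
    \<open>y\<close>.\<close>
  proof (cases "\<alpha> < ?t")
    case True
    then have "bl_filter (level_set F ?t)"
      by (intro level[of _ x]) auto
    then have "x * y \<in> level_set F ?t"
      unfolding bl_filter_iff_upset_mult_closed by (auto simp: level_set_def)
    then show ?thesis
      by (simp add: level_set_def le_max_iff_disj)
  qed auto
  moreover have "max (F y) \<alpha> \<ge> min (F x) \<beta>" (is "_ \<ge> ?t") if "x \<le> y" for x y
  proof (cases "\<alpha> < ?t")
    case True
    then have "bl_filter (level_set F ?t)"
      by (intro level[of _ x]) auto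
    moreover have "x \<in> level_set F ?t"
      by (simp add: level_set_def)
    ultimately have "y \<in> level_set F ?t"
      using that unfolding bl_filter_iff_upset_mult_closed by blast
    then show ?thesis
      by (simp add: level_set_def le_max_iff_disj)
  qed auto
  ultimately show "fuzzy_filter_thresholds \<alpha> \<beta> F"
    using assms(6) by (simp add: fuzzy_filter_thresholds_def)
qed

end
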